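(* For every $M\ge 0$, the ADER-IWF-RK method with $M+1$ Gauss--Legendre nodes is A-stable; moreover, for every $M\ge0$ and every number of iterations $K\ge1$, the ImADER method with $M+1$ Gauss--Legendre nodes and $K$ iterations is A-stable.
   Context: Let $t^0,\dots,t^M$ be the $M+1$ Gauss--Legendre nodes on $[0,1]$, and let $\phi_0,\dots,\phi_M$ be the Lagrange basis polynomials of degree $M$ in these nodes, $\phi_i(t^j)=\delta_{ij}$. For $i,j=0,\dots,M$ define $$M_{ij}=\phi_i(1)\phi_j(1)-\int_0^1\phi_i'(t)\phi_j(t)\,dt,\qquad R_{ij}=\int_0^1\phi_i(t)\phi_j(t)\,dt=\delta_{ij}w_j,\qquad b_i=w_i=\int_0^1\phi_i(t)\,dt .$$ The matrix $\underline{\underline{M}}$ is invertible; set $\underline{\underline{Q}}:=\underline{\underline{M}}^{-1}\underline{\underline{R}}$. ADER-IWF-RK Gauss--Legendre: the implicit Runge--Kutta method with $M+1$ stages, Butcher matrix $\underline{\underline{Q}}$ and weights $b$. ImADER Gauss--Legendre with $K$ iterations: the implicit Runge--Kutta method with $K(M+1)+1$ stages whose Butcher matrix is the block diagonal matrix $\mathrm{diag}(0,\underline{\underline{Q}},\dots,\underline{\underline{Q}})$ (one $1\times1$ zero block followed by $K$ copies of $\underline{\underline{Q}}$) and whose weight vector is $(0,\underline{0}^T,\dots,\underline{0}^T,b^T)$ (zero except on the last block). Equivalently, for $u'=F(u)$, each iteration $k=1,\dots,K$ solves $\underline{u}^{(k)}=\underline{1}u_n+\Delta t\,\underline{\underline{Q}}F(\underline{u}^{(k)})$,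 and then $u_{n+1}=u_n+\Delta t\,b^TF(\underline{u}^{(K)})$. The stability function of a Runge--Kutta method with matrix $A$ and weights $b$ is $R(z)=1+z\,b^T(Id-zA)^{-1}\underline{1}$ (a rational function of $z$). The method is A-stable if $|R(z)|\le1$ for all $z\in\mathbb{C}$ with $\mathrm{Re}\,z\le0$. *)

theory Defs
  imports
    "HOL-Complex_Analysis.Complex_Analysis"
    "HOL-Computational_Algebra.Polynomial"
    "Jordan_Normal_Form.Gauss_Jordan_Elimination"
begin

section \<open>Runge--Kutta methods and A-stability\<close>

text \<open>A Runge--Kutta method is given by its Butcher matrix and its weights.\<close>

type_synonym rk_method = "real Matrix.mat \<times> real Matrix.vec"

text \<open>At the finitely many points where \<open>Id - z A\<close> is singular, the value of
  \<open>stability_function\<close> is computed with an unspecified matrix; \<open>A_stable\<close> does not depend on it.\<close>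

definition stability_function :: "rk_method \<Rightarrow> complex \<Rightarrow> complex" where
  "stability_function rk z =
     (let A = map_mat complex_of_real (fst rk);
          b = map_vec complex_of_real (snd rk);
          s = dim_row A
      in 1 + z * (scalar_prod b (the (mat_inverse (1\<^sub>m s - z \<cdot>\<^sub>m A)) *\<^sub>v Matrix.vec s (\<lambda>_. 1))))"

text \<open>The stability function is understood as a rational function: a point where
  \<open>Id - z A\<close> is singular is either a pole, at which the bound fails, or
  a removable singularity, at which the rational function takes the value \<open>remove_sings\<close>.
  At all other points \<open>remove_sings\<close> changes nothing.\<close>

definition A_stable :: "rk_method \<Rightarrow> bool" where
  "A_stable rk \<longleftrightarrow>
     (\<forall>z. Re z \<le> 0 \<longrightarrow>
        \<not> is_pole (stability_function rk) z \<and>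
        cmod (remove_sings (stability_function rk) z) \<le> 1)"

section \<open>Gauss--Legendre nodes and the Lagrange basis\<close>

text \<open>The Legendre polynomial on \<open>[-1, 1]\<close>, by Rodrigues' formula.\<close>

definition legendre_poly :: "nat \<Rightarrow> real poly" where
  "legendre_poly n = Polynomial.smult (1 / (2 ^ n * fact n)) ((pderiv ^^ n) ([:- 1, 0, 1:] ^ n))"

text \<open>The \<open>n\<close>-point Gauss--Legendre nodes on \<open>[0, 1]\<close>, in increasing order, are the roots of
  \<open>legendre_poly n\<close> transported by \<open>t \<mapsto> 2 * t - 1\<close>.\<close>

definition gauss_legendre_nodes :: "nat \<Rightarrow> real list" where
  "gauss_legendre_nodes n = sorted_list_of_set {t. poly (legendre_poly n) (2 * t - 1) = 0}"

abbreviation node :: "nat \<Rightarrow> nat \<Rightarrow> real" where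
  "node M i \<equiv> gauss_legendre_nodes (M + 1) ! i"

definition lagrange_basis :: "nat \<Rightarrow> nat \<Rightarrow> real poly" where
  "lagrange_basis M i =
     (\<Prod>j\<in>{..M} - {i}. Polynomial.smult (1 / (node M i - node M j)) [:- node M j, 1:])"

section \<open>The ADER methods\<close>

definition ader_M :: "nat \<Rightarrow> real Matrix.mat" where
  "ader_M M = Matrix.mat (M + 1) (M + 1) (\<lambda>(i, j).
     poly (lagrange_basis M i) 1 * poly (lagrange_basis M j) 1
     - integral {0..1} (\<lambda>t. poly (pderiv (lagrange_basis M i)) t * poly (lagrange_basis M j) t))"

definition ader_R :: "nat \<Rightarrow> real Matrix.mat" where
  "ader_R M = Matrix.mat (M + 1) (M + 1) (\<lambda>(i, j).
     integral {0..1} (\<lambda>t. poly (lagrange_basis M i) t * poly (lagrange_basis M j) t))"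

definition ader_b :: "nat \<Rightarrow> real Matrix.vec" where
  "ader_b M = Matrix.vec (M + 1) (\<lambda>i. integral {0..1} (poly (lagrange_basis M i)))"

definition ader_Q :: "nat \<Rightarrow> real Matrix.mat" where
  "ader_Q M = the (mat_inverse (ader_M M)) * ader_R M"

definition ader_iwf_rk :: "nat \<Rightarrow> rk_method" where
  "ader_iwf_rk M = (ader_Q M, ader_b M)"

text \<open>For \<open>K \<ge> 1\<close> iterations there are \<open>K * (M + 1) + 1\<close> stages.\<close>

definition im_ader :: "nat \<Rightarrow> nat \<Rightarrow> rk_method" where
  "im_ader M K =
     (diag_block_mat (0\<^sub>m 1 1 # replicate K (ader_Q M)),
      0\<^sub>v (1 + (K - 1) * (M + 1)) @\<^sub>v ader_b M)"

end

theory Submission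
  imports Defs "Jordan_Normal_Form.Determinant"
begin

text \<open>Let \<open>u\<close> be the polynomial of degree at most \<open>M\<close> whose values at the nodes are the stage values, that is,
  the solution of \<open>(Id - z Q) u = 1\<close>. After multiplication by the matrix \<^const>\<open>ader_M\<close>, these
  equations become the Galerkin equation
  \<open>v(1) u(1) - \<integral> v' u = v(0) + z \<integral> v u\<close> for all polynomials \<open>v\<close> of degree at most \<open>M\<close>,
  where the integrals are over \<open>[0, 1]\<close>. The test polynomial \<open>v = 1\<close> shows that the stability function
  \<open>1 + z \<integral> u\<close> equals \<open>u(1)\<close>. Testing with the complex conjugate of \<open>u\<close> and taking real parts gives the energy identity
  \<open>\<bar>u(1)\<bar>\<^sup>2 + \<bar>u(0) - 1\<bar>\<^sup>2 = 1 + 2 Re z \<integral> \<bar>u\<bar>\<^sup>2\<close>, so \<open>\<bar>u(1)\<bar> \<le> 1\<close> for \<open>Re z \<le> 0\<close>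
  (lemmas \<open>galerkin_end_value\<close> and \<open>galerkin_end_value_le_1\<close>).

  The same identity with zero right-hand side shows that \<open>Id - z Q\<close> is invertible for all
  \<open>z\<close> in the closed left half-plane: a solution has \<open>u(0) = 0\<close>, then satisfies \<open>u' = z u\<close>
  exactly, and so vanishes (lemma \<open>galerkin_homogeneous_trivial\<close>). For \<open>z = 0\<close>
  this is the invertibility of \<^const>\<open>ader_M\<close>. Hence the stability function is continuous at these points (lemma
  \<open>isCont_stability_function\<close>): there are no poles, and removing singularities does not change the values.

  That stage values correspond to polynomials of degree at most \<open>M\<close> rests on the nodes being
  \<open>M + 1\<close> distinct points, which follows from Rodrigues' formula and Rolle's theorem
  (lemma \<open>card_legendre_roots\<close>). Finally, in the
  block-diagonal method with several iterations the stages of the last block decouple from the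
  others and carry all the weights, so its stability function on the left half-plane is that
  of the method with a single block (lemma \<open>stability_function_block_diag\<close>).\<close>

section \<open>Gauss--Legendre nodes and Lagrange interpolation\<close>

text \<open>Rolle's theorem, applied to each pair of neighbouring roots. Recording that the new roots lie
  strictly between the extreme old ones lets the lemma be iterated without leaving \<open>(-1, 1)\<close>.\<close>
lemma roots_of_pderiv_between_roots:
  fixes p :: "real poly"
  assumes "finite S" "S \<noteq> {}" "\<And>x. x \<in> S \<Longrightarrow> poly p x = 0"
  shows "\<exists>T. finite T \<and> Suc (card T) = card S \<and>
             (\<forall>x\<in>T. poly (pderiv p) x = 0 \<and> Min S < x \<and> x < Max S)"
  using assms
proof (induction S rule: finite_linorder_max_induct)
  case empty
  then show ?case by simp
next
  case (insert b A)
  show ?case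
  proof (cases "A = {}")
    case True
    then show ?thesis by (intro exI[of _ "{}"]) auto
  next
    case False
    with insert obtain T where T: "finite T" "Suc (card T) = card A"
      "\<forall>x\<in>T. poly (pderiv p) x = 0 \<and> Min A < x \<and> x < Max A"
      by auto
    define a where "a = Max A"
    have a: "a \<in> A" "a < b"
      using insert.hyps False by (auto simp: a_def)
    obtain c where c: "a < c" "c < b" "poly p b - poly p a = (b - a) * poly (pderiv p) c"
      using poly_MVT[OF \<open>a < b\<close>] by blast
    have "poly (pderiv p) c = 0"
      using c a insert.prems by simp
    moreover have "Min A \<le> a"
      using a insert.hyps by simp
    moreover have "Min (insert b A) = Min A"
      using a(2) \<open>Min A \<le> a\<close> unfolding Min_insert[OF insert.hyps(1) False] by linarith
    moreover have "Max (insert b A) = b"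
      using a(2) unfolding Max_insert[OF insert.hyps(1) False] a_def by linarith
    moreover have "c \<notin> T" "b \<notin> A"
      using T c a_def insert.hyps by fastforce+
    moreover have "x < b" if "x \<in> T" for x
      using T(3) that a c a_def by fastforce
    ultimately show ?thesis
      using T c insert.hyps by (intro exI[of _ "insert c T"]) auto
  qed
qed

lemma power_dvd_pderiv:
  fixes p q :: "'a::idom poly"
  assumes "q ^ n dvd p"
  shows "q ^ (n - 1) dvd pderiv p"
proof -
  obtain r where r: "p = q ^ n * r"
    using assms by (auto simp: dvd_def)
  have "q ^ (n - 1) dvd q ^ n * pderiv r"
    by (simp add: le_imp_power_dvd)
  moreover have "q ^ (n - 1) dvd pderiv (q ^ n) * r"
    by (simp add: pderiv_power dvd_smult)
  ultimately show ?thesis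
    unfolding r pderiv_mult by (metis dvd_add mult.commute)
qed

lemma power_dvd_higher_pderiv:
  fixes p q :: "'a::idom poly"
  assumes "q ^ n dvd p"
  shows "q ^ (n - k) dvd (pderiv ^^ k) p"
proof (induction k)
  case 0
  then show ?case using assms by simp
next
  case (Suc k)
  then show ?case using power_dvd_pderiv[OF Suc] by simp
qed

text \<open>Each differentiation gains one root: as long as fewer than \<open>n\<close> derivatives have been taken,
  \<open>x\<^sup>2 - 1\<close> still divides the polynomial, so \<open>-1\<close> and \<open>1\<close> are roots besides the \<open>k\<close> interior
  ones, and Rolle's theorem turns these \<open>k + 2\<close> roots into \<open>k + 1\<close> interior roots of the derivative.\<close>
lemma higher_pderiv_power_roots:
  assumes "k \<le> n"
  shows "\<exists>S. finite S \<and> card S = k \<and> S \<subseteq> {-1<..<1} \<and>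
             (\<forall>x\<in>S. poly ((pderiv ^^ k) ([:-1, 0, 1:] ^ n)) x = (0::real))"
  using assms
proof (induction k)
  case 0
  then show ?case by (intro exI[of _ "{}"]) auto
next
  case (Suc k)
  define f :: "real poly" where "f = (pderiv ^^ k) ([:-1, 0, 1:] ^ n)"
  obtain S where S: "finite S" "card S = k" "S \<subseteq> {-1<..<1}" "\<forall>x\<in>S. poly f x = 0"
    using Suc by (auto simp: f_def)
  have "[:-1, 0, 1:] ^ (n - k) dvd f"
    unfolding f_def by (rule power_dvd_higher_pderiv) simp
  moreover have "[:-1, 0, 1:] dvd [:-1, 0, 1::real:] ^ (n - k)"
    using Suc.prems by (intro dvd_power) auto
  ultimately have dvd: "[:-1, 0, 1:] dvd f"
    by (rule dvd_trans[rotated])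
  then have ends: "poly f 1 = 0" "poly f (-1) = 0"
    by (auto simp: dvd_def)
  have "-1 \<notin> insert 1 S" "1 \<notin> S"
    using S(3) by auto
  then have card: "card (insert (-1) (insert 1 S)) = Suc (Suc k)"
    using S by simp
  have min_max: "Min (insert (-1) (insert 1 S)) = -1" "Max (insert (-1) (insert 1 S)) = 1"
    using S(1,3) by (intro Min_eqI Max_eqI; force)+
  obtain T where "finite T" "Suc (card T) = Suc (Suc k)"
      "\<forall>x\<in>T. poly (pderiv f) x = 0 \<and> -1 < x \<and> x < 1"
    using roots_of_pderiv_between_roots[of "insert (-1) (insert 1 S)" f] S(1,4) ends
    unfolding card min_max by auto
  then show ?case
    by (intro exI[of _ T]) (auto simp: f_def)
qed

text \<open>Rodrigues' formula provides \<open>n\<close> roots, and the degree is \<open>n\<close>. The case \<open>n = 0\<close> is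
  separate because a polynomial of degree \<open>0\<close> need not be nonzero.\<close>
lemma card_legendre_roots: "card {x. poly (legendre_poly n) x = 0} = n"
proof (cases "n = 0")
  case True
  then show ?thesis by (simp add: legendre_poly_def)
next
  case False
  define f :: "real poly" where "f = (pderiv ^^ n) ([:-1, 0, 1:] ^ n)"
  have roots: "{x. poly (legendre_poly n) x = 0} = {x. poly f x = 0}"
    by (simp add: legendre_poly_def f_def)
  have deg: "degree f = n"
    by (simp add: f_def degree_higher_pderiv degree_power_eq)
  then have "f \<noteq> 0"
    using False by auto
  obtain S where S: "finite S" "card S = n" "\<forall>x\<in>S. poly f x = 0"
    using higher_pderiv_power_roots[of n n] by (auto simp: f_def)
  have "n \<le> card {x. poly f x = 0}"
    using S card_mono[OF poly_roots_finite[OF \<open>f \<noteq> 0\<close>], of S] by auto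
  with card_poly_roots_bound[OF \<open>f \<noteq> 0\<close>] deg show ?thesis
    by (simp add: roots)
qed

text \<open>The substitution \<open>t \<mapsto> 2 * t - 1\<close> maps the nodes bijectively to the roots of the Legendre
  polynomial. Hence the \<open>M + 1\<close> indices up to \<open>M\<close> name different points, which makes the
  Lagrange polynomials a basis of the polynomials of degree at most \<open>M\<close>.\<close>
lemma gauss_legendre_nodes_distinct_length:
  "distinct (gauss_legendre_nodes n)" "length (gauss_legendre_nodes n) = n"
proof -
  have "bij_betw (\<lambda>t::real. 2 * t - 1) {t. poly (legendre_poly n) (2 * t - 1) = 0}
          {x. poly (legendre_poly n) x = 0}"
    by (rule bij_betwI[where g = "\<lambda>x. (x + 1) / 2"]) (auto simp: field_simps)
  then show "length (gauss_legendre_nodes n) = n"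
    by (simp add: gauss_legendre_nodes_def bij_betw_same_card card_legendre_roots)
qed (simp add: gauss_legendre_nodes_def)

lemma node_eq_iff: "i \<le> M \<Longrightarrow> j \<le> M \<Longrightarrow> node M i = node M j \<longleftrightarrow> i = j"
  using gauss_legendre_nodes_distinct_length[of "M + 1"] by (simp add: nth_eq_iff_index_eq)

lemma degree_lagrange_basis:
  assumes "i \<le> M"
  shows "degree (lagrange_basis M i) \<le> M"
proof -
  have "degree (lagrange_basis M i)
      \<le> (\<Sum>j\<in>{..M} - {i}. degree (Polynomial.smult (1 / (node M i - node M j)) [:- node M j, 1:]))"
    unfolding lagrange_basis_def by (rule order.trans[OF degree_prod_sum_le]) auto
  also have "\<dots> \<le> (\<Sum>j\<in>{..M} - {i}. 1)"
    by (intro sum_mono) (auto simp: degree_smult_eq)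
  also have "\<dots> = M"
    using assms by simp
  finally show ?thesis .
qed

lemma poly_lagrange_basis_node:
  assumes "i \<le> M" "j \<le> M"
  shows "poly (lagrange_basis M i) (node M j) = (if i = j then 1 else 0)"
proof (cases "i = j")
  case True
  then show ?thesis
    using assms
    by (auto simp: lagrange_basis_def poly_prod node_eq_iff[simplified] simp flip: diff_divide_distrib
        intro!: prod.neutral)
next
  case False
  then have "\<exists>k\<in>{..M} - {i}. poly (Polynomial.smult (1 / (node M i - node M k)) [:- node M k, 1:]) (node M j) = 0"
    using assms by (intro bexI[of _ j]) auto
  then show ?thesis
    using False unfolding lagrange_basis_def poly_prod by (simp add: prod_zero)
qed

definition nodal_poly :: "nat \<Rightarrow> (nat \<Rightarrow> real) \<Rightarrow> real poly" where
  "nodal_poly M u = (\<Sum>j\<le>M. Polynomial.smult (u j) (lagrange_basis M j))"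

lemma degree_nodal_poly: "degree (nodal_poly M u) \<le> M"
  unfolding nodal_poly_def
  by (intro degree_sum_le) (auto intro: order.trans[OF degree_smult_le] degree_lagrange_basis)

lemma poly_nodal_poly_node:
  assumes "i \<le> M"
  shows "poly (nodal_poly M u) (node M i) = u i"
proof -
  have "poly (nodal_poly M u) (node M i) = (\<Sum>j\<le>M. if j = i then u j else 0)"
    using assms unfolding nodal_poly_def poly_sum poly_smult
    by (intro sum.cong) (auto simp: poly_lagrange_basis_node[simplified])
  then show ?thesis
    using assms by simp
qed

lemma nodal_poly_interpolates:
  assumes "degree p \<le> M"
  shows "nodal_poly M (\<lambda>i. poly p (node M i)) = p"
proof (rule poly_eqI_degree[where A = "node M ` {..M}"])
  have "inj_on (node M) {..M}"
    by (auto intro!: inj_onI simp: node_eq_iff[simplified])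
  then have card: "card (node M ` {..M}) = Suc M"
    by (simp add: card_image)
  show "degree (nodal_poly M (\<lambda>i. poly p (node M i))) < card (node M ` {..M})"
    unfolding card by (rule le_imp_less_Suc[OF degree_nodal_poly])
  show "degree p < card (node M ` {..M})"
    unfolding card using assms by simp
qed (auto simp: poly_nodal_poly_node[simplified])

section \<open>The Galerkin form of the stage equations\<close>
definition unit_integral :: "real poly \<Rightarrow> real" where
  "unit_integral p = integral {0..1} (poly p)"

lemma poly_integrable_on_unit: "poly p integrable_on {0..1}" for p :: "real poly"
  by (intro integrable_continuous_real continuous_intros)

lemma unit_integral_0 [simp]: "unit_integral 0 = 0"
  by (simp add: unit_integral_def poly_0[abs_def])

lemma unit_integral_add: "unit_integral (p + q) = unit_integral p + unit_integral q"
  using Henstock_Kurzweil_Integration.integral_add[OF poly_integrable_on_unit poly_integrable_on_unit, of p q]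
  by (simp add: unit_integral_def poly_add[abs_def])

lemma unit_integral_smult: "unit_integral (Polynomial.smult c p) = c * unit_integral p"
  by (simp add: unit_integral_def poly_smult[abs_def])

lemma unit_integral_diff: "unit_integral (p - q) = unit_integral p - unit_integral q"
  using unit_integral_add[of p "Polynomial.smult (-1) q"] by (simp add: unit_integral_smult[of "-1", simplified])

lemma unit_integral_sum: "unit_integral (sum f A) = (\<Sum>i\<in>A. unit_integral (f i))"
  by (induction A rule: infinite_finite_induct) (simp_all add: unit_integral_add)

lemma unit_integral_pderiv: "unit_integral (pderiv p) = poly p 1 - poly p 0"
proof -
  have "(poly (pderiv p) has_integral poly p 1 - poly p 0) {0..1}"
    by (rule fundamental_theorem_of_calculus)
      (auto intro!: DERIV_subset[OF poly_DERIV] simp flip: has_real_derivative_iff_has_vector_derivative)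
  then show ?thesis
    by (simp add: unit_integral_def integral_unique)
qed

lemma unit_integral_square_nonneg: "0 \<le> unit_integral (p * p)"
  unfolding unit_integral_def by (rule integral_nonneg[OF poly_integrable_on_unit]) simp

lemma unit_integral_square_eq_0:
  assumes "unit_integral (p * p) = 0"
  shows "p = 0"
proof -
  have "poly (p * p) x = 0" if "x \<in> {0..1}" for x
    using assms that integral_eq_0_iff[of 0 1 "poly (p * p)"]
    by (auto simp: unit_integral_def continuous_intros)
  then have "{0..1} \<subseteq> {x. poly p x = 0}"
    by auto
  then have "infinite {x. poly p x = 0}"
    by (rule infinite_super) (simp add: infinite_Icc_iff)
  then show ?thesis
    using poly_roots_finite by blast
qed

text \<open>The matrix of this bilinear form in the Lagrange basis is \<^const>\<open>ader_M\<close>. It is the weak form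
  of the derivative in time: the boundary value at \<open>1\<close> is kept, and the one at \<open>0\<close> is left to the
  initial datum.\<close>
definition ader_form :: "real poly \<Rightarrow> real poly \<Rightarrow> real" where
  "ader_form v p = poly v 1 * poly p 1 - unit_integral (pderiv v * p)"

lemma ader_form_by_parts: "ader_form v p = poly v 0 * poly p 0 + unit_integral (v * pderiv p)"
  using unit_integral_pderiv[of "v * p"]
  by (simp add: ader_form_def pderiv_mult unit_integral_add algebra_simps)

text \<open>Both boundary terms left by the integration by parts are squares with a positive sign; this is
  the source of stability.\<close>
lemma ader_form_square: "ader_form p p = (poly p 1 ^ 2 + poly p 0 ^ 2) / 2"
  using ader_form_by_parts[of p p] by (simp add: ader_form_def mult.commute power2_eq_square)

lemma ader_form_sum_left:
  "ader_form (\<Sum>i\<in>A. Polynomial.smult (c i) (f i)) p = (\<Sum>i\<in>A. c i * ader_form (f i) p)"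
  by (simp add: ader_form_def higher_pderiv_sum[of 1, simplified] pderiv_smult sum_distrib_right unit_integral_sum poly_sum
      unit_integral_smult sum_subtractf right_diff_distrib mult.assoc)

lemma ader_form_sum_right:
  "ader_form v (\<Sum>i\<in>A. Polynomial.smult (c i) (f i)) = (\<Sum>i\<in>A. c i * ader_form v (f i))"
  by (simp add: ader_form_def sum_distrib_left unit_integral_sum poly_sum
      unit_integral_smult sum_subtractf right_diff_distrib mult.left_commute)

text \<open>The pair \<open>(p, q)\<close> stands for the complex polynomial \<open>u = p + \<i> q\<close>. Writing \<open>a(v, u)\<close> for
  \<^const>\<open>ader_form\<close>, the equation is \<open>a(v, u) = c v(0) + z \<integral> v u\<close> for every test polynomial \<open>v\<close>,
  the discrete form of \<open>u' = z u\<close>, \<open>u(0) = c\<close>. Since the test polynomials may be taken real, splitting into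
  real and imaginary parts keeps all polynomials real.\<close>
definition galerkin_solution :: "nat \<Rightarrow> complex \<Rightarrow> real \<Rightarrow> real poly \<Rightarrow> real poly \<Rightarrow> bool" where
  "galerkin_solution M z c p q \<longleftrightarrow>
     (\<forall>v. degree v \<le> M \<longrightarrow>
        ader_form v p = c * poly v 0 + Re z * unit_integral (v * p) - Im z * unit_integral (v * q) \<and>
        ader_form v q = Re z * unit_integral (v * q) + Im z * unit_integral (v * p))"

text \<open>This is the real part of the equation tested with the complex conjugate of \<open>u\<close>. The terms
  with \<open>Im z\<close> cancel.\<close>
lemma galerkin_energy:
  assumes "galerkin_solution M z c p q" "degree p \<le> M" "degree q \<le> M"
  shows "poly p 1 ^ 2 + poly q 1 ^ 2 + poly p 0 ^ 2 + poly q 0 ^ 2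
    = 2 * c * poly p 0 + 2 * Re z * (unit_integral (p * p) + unit_integral (q * q))"
proof -
  have "ader_form p p + ader_form q q
      = c * poly p 0 + Re z * (unit_integral (p * p) + unit_integral (q * q))"
    using assms by (simp add: galerkin_solution_def algebra_simps)
  then show ?thesis
    by (simp add: ader_form_square field_simps)
qed

text \<open>Completing the square in the energy identity gives
  \<open>\<bar>u(1)\<bar>\<^sup>2 + \<bar>u(0) - 1\<bar>\<^sup>2 = 1 + 2 Re z \<integral> \<bar>u\<bar>\<^sup>2\<close>.\<close>
lemma galerkin_end_value_le_1:
  assumes "galerkin_solution M z 1 p q" "degree p \<le> M" "degree q \<le> M" "Re z \<le> 0"
  shows "cmod (Complex (poly p 1) (poly q 1)) \<le> 1"
proof -
  have "Re z * (unit_integral (p * p) + unit_integral (q * q)) \<le> 0"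
    using assms(4) unit_integral_square_nonneg by (intro mult_nonpos_nonneg add_nonneg_nonneg)
  then have "poly p 1 ^ 2 + poly q 1 ^ 2 + (poly p 0 - 1) ^ 2 + poly q 0 ^ 2 \<le> 1"
    using galerkin_energy[OF assms(1-3)] by (simp add: power2_eq_square algebra_simps)
  then have "poly p 1 ^ 2 + poly q 1 ^ 2 \<le> 1"
    using zero_le_power2[of "poly p 0 - 1"] zero_le_power2[of "poly q 0"] by linarith
  then show ?thesis
    by (simp add: cmod_def)
qed

text \<open>Testing with the constant \<open>1\<close> identifies the quadrature update \<open>c + z \<integral> u\<close> with the end
  value \<open>u(1)\<close>.\<close>
lemma galerkin_end_value:
  assumes "galerkin_solution M z c p q"
  shows "Complex (poly p 1) (poly q 1)
    = of_real c + z * Complex (unit_integral p) (unit_integral q)"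
proof -
  have "ader_form 1 p = c + Re z * unit_integral p - Im z * unit_integral q"
    "ader_form 1 q = Re z * unit_integral q + Im z * unit_integral p"
    using assms[unfolded galerkin_solution_def, rule_format, of 1] by simp_all
  then show ?thesis
    by (simp add: ader_form_def complex_eq_iff)
qed

text \<open>A polynomial cannot be a nontrivial exponential: for \<open>c \<noteq> 0\<close> the two sides have equal degrees
  only if \<open>s\<close> is constant.\<close>
lemma pderiv_eq_smult_imp_0:
  fixes s :: "real poly"
  assumes "pderiv s = Polynomial.smult c s" "poly s 0 = 0"
  shows "s = 0"
proof -
  have "degree s = 0"
    using degree_pderiv[of s] arg_cong[OF assms(1), of degree] assms(1)
    by (cases "c = 0") (auto simp: pderiv_eq_0_iff)
  then show ?thesis
    using assms(2) by (auto elim: degree_eq_zeroE)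
qed

text \<open>By the energy identity \<open>u(0) = 0\<close>. Then the equation says that \<open>u' - z u\<close> is orthogonal to all
  polynomials of degree at most \<open>M\<close>; being one of them, it vanishes. Working with
  \<open>s = \<bar>u\<bar>\<^sup>2\<close>, which satisfies \<open>s' = 2 Re z s\<close>, covers the imaginary axis and the
  open half-plane alike.\<close>
lemma galerkin_homogeneous_trivial:
  assumes sol: "galerkin_solution M z 0 p q" and deg: "degree p \<le> M" "degree q \<le> M"
    and z: "Re z \<le> 0"
  shows "p = 0 \<and> q = 0"
proof -
  have "Re z * (unit_integral (p * p) + unit_integral (q * q)) \<le> 0"
    using z unit_integral_square_nonneg by (intro mult_nonpos_nonneg add_nonneg_nonneg)
  then have "poly p 1 ^ 2 + poly q 1 ^ 2 + poly p 0 ^ 2 + poly q 0 ^ 2 \<le> 0"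
    using galerkin_energy[OF sol deg] by simp
  then have "poly p 0 ^ 2 = 0" "poly q 0 ^ 2 = 0"
    using zero_le_power2[of "poly p 0"] zero_le_power2[of "poly q 0"]
      zero_le_power2[of "poly p 1"] zero_le_power2[of "poly q 1"] by linarith+
  then have start: "poly p 0 = 0" "poly q 0 = 0"
    by simp_all
  (* dp and dq are the real and imaginary parts of u' - z u. *)
  define dp where "dp = pderiv p - Polynomial.smult (Re z) p + Polynomial.smult (Im z) q"
  define dq where "dq = pderiv q - Polynomial.smult (Re z) q - Polynomial.smult (Im z) p"
  have "unit_integral (v * dp) = 0 \<and> unit_integral (v * dq) = 0" if "degree v \<le> M" for v
    using sol[unfolded galerkin_solution_def, rule_format, OF that] start
    by (simp add: ader_form_by_parts dp_def dq_def algebra_simps unit_integral_add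
        unit_integral_diff unit_integral_smult)
  moreover have "degree dp \<le> M" "degree dq \<le> M"
    using deg unfolding dp_def dq_def
    by (auto intro!: degree_add_le degree_diff_le order.trans[OF degree_smult_le] simp: degree_pderiv)
  ultimately have "dp = 0" "dq = 0"
    by (auto intro: unit_integral_square_eq_0)
  then have dpq: "pderiv p = Polynomial.smult (Re z) p - Polynomial.smult (Im z) q"
    "pderiv q = Polynomial.smult (Re z) q + Polynomial.smult (Im z) p"
    by (simp_all add: dp_def dq_def algebra_simps)
  have "pderiv (p * p + q * q) = Polynomial.smult (2 * Re z) (p * p + q * q)"
    by (rule poly_ext) (simp add: pderiv_mult pderiv_add dpq algebra_simps)
  then have "p * p + q * q = 0"
    by (rule pderiv_eq_smult_imp_0) (simp add: start)
  then have "poly p x * poly p x + poly q x * poly q x = 0" for x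
    by (metis poly_0 poly_add poly_mult)
  then have "poly p x = 0 \<and> poly q x = 0" for x
    by (simp add: sum_squares_eq_zero_iff)
  then show ?thesis
    by (simp add: poly_eq_poly_eq_iff[symmetric] fun_eq_iff)
qed

text \<open>It suffices to test with the Lagrange polynomials, because every admissible test polynomial
  is a combination of them.\<close>
lemma galerkin_solution_nodal:
  fixes w :: "nat \<Rightarrow> complex"
  assumes "\<And>i. i \<le> M \<Longrightarrow>
      (\<Sum>j\<le>M. (of_real (ader_form (lagrange_basis M i) (lagrange_basis M j))
         - z * of_real (unit_integral (lagrange_basis M i * lagrange_basis M j))) * w j)
      = of_real (c * poly (lagrange_basis M i) 0)"
  shows "galerkin_solution M z c (nodal_poly M (\<lambda>j. Re (w j))) (nodal_poly M (\<lambda>j. Im (w j)))"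
proof -
  define p q where pq: "p = nodal_poly M (\<lambda>j. Re (w j))" "q = nodal_poly M (\<lambda>j. Im (w j))"
  have basis: "ader_form (lagrange_basis M i) p = c * poly (lagrange_basis M i) 0
        + Re z * unit_integral (lagrange_basis M i * p) - Im z * unit_integral (lagrange_basis M i * q)
      \<and> ader_form (lagrange_basis M i) q
        = Re z * unit_integral (lagrange_basis M i * q) + Im z * unit_integral (lagrange_basis M i * p)"
    if "i \<le> M" for i
  proof -
    define a r where "a j = ader_form (lagrange_basis M i) (lagrange_basis M j)"
      and "r j = unit_integral (lagrange_basis M i * lagrange_basis M j)" for j
    have nodal: "ader_form (lagrange_basis M i) (nodal_poly M u) = (\<Sum>j\<le>M. u j * a j)"
      "unit_integral (lagrange_basis M i * nodal_poly M u) = (\<Sum>j\<le>M. u j * r j)" for u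
      by (simp_all add: nodal_poly_def ader_form_sum_right sum_distrib_left unit_integral_sum
          unit_integral_smult a_def r_def)
    have "(\<Sum>j\<le>M. (of_real (a j) - z * of_real (r j)) * w j) = of_real (c * poly (lagrange_basis M i) 0)"
      using assms[OF that] by (simp add: a_def r_def)
    from arg_cong[OF this, of Re] arg_cong[OF this, of Im]
    show ?thesis
      by (simp add: pq nodal sum_distrib_left sum.distrib sum_subtractf algebra_simps)
  qed
  have "ader_form v p = c * poly v 0 + Re z * unit_integral (v * p) - Im z * unit_integral (v * q) \<and>
        ader_form v q = Re z * unit_integral (v * q) + Im z * unit_integral (v * p)"
    if "degree v \<le> M" for v
  proof -
    define a where "a i = poly v (node M i)" for i
    have v: "v = (\<Sum>i\<le>M. Polynomial.smult (a i) (lagrange_basis M i))"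
      using nodal_poly_interpolates[OF that] by (simp add: nodal_poly_def a_def)
    have form: "ader_form v r = (\<Sum>i\<le>M. a i * ader_form (lagrange_basis M i) r)" for r
      by (subst v) (rule ader_form_sum_left)
    have int: "unit_integral (v * r) = (\<Sum>i\<le>M. a i * unit_integral (lagrange_basis M i * r))" for r
      by (subst v) (simp add: sum_distrib_right unit_integral_sum unit_integral_smult)
    have start: "poly v 0 = (\<Sum>i\<le>M. a i * poly (lagrange_basis M i) 0)"
      by (subst v) (simp add: poly_sum)
    show ?thesis
      unfolding form int start
      by (simp add: basis sum_distrib_left sum.distrib sum_subtractf algebra_simps)
  qed
  then show ?thesis
    by (simp add: galerkin_solution_def pq)
qed

section \<open>Stability functions and block-diagonal methods\<close>
lemma isCont_det:
  fixes F :: "complex \<Rightarrow> complex Matrix.mat"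
  assumes "\<And>w. F w \<in> carrier_mat n n"
    and "\<And>i j. i < n \<Longrightarrow> j < n \<Longrightarrow> isCont (\<lambda>w. F w $$ (i, j)) z"
  shows "isCont (\<lambda>w. Determinant.det (F w)) z"
proof -
  have "isCont (\<lambda>w. \<Sum>p\<in>{p. p permutes {0..<n}}. signof p * (\<Prod>i = 0..<n. F w $$ (i, p i))) z"
  proof (intro continuous_intros)
    fix p i assume "p \<in> {p. p permutes {0..<n}}" "i \<in> {0..<n}"
    then have "i < n" "p i < n"
      using permutes_in_image[of p "{0..<n}" i] by auto
    then show "isCont (\<lambda>w. F w $$ (i, p i)) z"
      by (rule assms(2))
  qed
  then show ?thesis
    by (simp only: det_def'[OF assms(1)])
qed

lemma isCont_adj_mat:
  fixes F :: "complex \<Rightarrow> complex Matrix.mat"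
  assumes F: "\<And>w. F w \<in> carrier_mat n n"
    and cont: "\<And>i j. i < n \<Longrightarrow> j < n \<Longrightarrow> isCont (\<lambda>w. F w $$ (i, j)) z"
    and "i < n" "j < n"
  shows "isCont (\<lambda>w. adj_mat (F w) $$ (i, j)) z"
proof -
  have minor: "mat_delete (F w) j i \<in> carrier_mat (n - 1) (n - 1)" for w
    using carrier_matD[OF F] by (auto simp: mat_delete_def)
  have "isCont (\<lambda>w. mat_delete (F w) j i $$ (k, l)) z" if "k < n - 1" "l < n - 1" for k l
  proof -
    have "mat_delete (F w) j i $$ (k, l)
        = F w $$ (if k < j then k else Suc k, if l < i then l else Suc l)" for w
      using that carrier_matD[OF F] by (simp add: mat_delete_def)
    then show ?thesis
      using that by (simp only:) (rule cont; auto)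
  qed
  then have "isCont (\<lambda>w. Determinant.det (mat_delete (F w) j i)) z"
    by (intro isCont_det[OF minor])
  then have "isCont (\<lambda>w. cofactor (F w) j i) z"
    unfolding cofactor_def by (intro continuous_intros)
  then show ?thesis
    using assms(3,4) carrier_matD[OF F] by (simp add: adj_mat_def)
qed

lemma the_mat_inverse:
  fixes A :: "'a::field Matrix.mat"
  assumes A: "A \<in> carrier_mat n n" and "Determinant.det A \<noteq> 0"
  shows "the (mat_inverse A) \<in> carrier_mat n n" "A * the (mat_inverse A) = 1\<^sub>m n"
    "the (mat_inverse A) * A = 1\<^sub>m n"
proof -
  have "mat_inverse A \<noteq> None"
    using mat_inverse(1)[OF A, where b = undefined] det_non_zero_imp_unit[OF assms] by metis
  then obtain B where "mat_inverse A = Some B"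
    by blast
  then show "the (mat_inverse A) \<in> carrier_mat n n" "A * the (mat_inverse A) = 1\<^sub>m n"
      "the (mat_inverse A) * A = 1\<^sub>m n"
    using mat_inverse(2)[OF A] by auto
qed

lemma the_mat_inverse_adj:
  fixes A :: "'a::field Matrix.mat"
  assumes A: "A \<in> carrier_mat n n" and det: "Determinant.det A \<noteq> 0"
  shows "the (mat_inverse A) = (1 / Determinant.det A) \<cdot>\<^sub>m adj_mat A"
proof -
  let ?I = "the (mat_inverse A)"
  note I = the_mat_inverse[OF assms]
  have "adj_mat A = (?I * A) * adj_mat A"
    using I adj_mat(1)[OF A] by simp
  also have "\<dots> = ?I * (A * adj_mat A)"
    using I(1) A adj_mat(1)[OF A] by (rule assoc_mult_mat)
  also have "\<dots> = Determinant.det A \<cdot>\<^sub>m ?I"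
    using I(1) by (simp add: adj_mat(2)[OF A] mult_smult_distrib[of _ n n _ n])
  finally show ?thesis
    using I(1) det by (intro eq_matI) auto
qed

definition stage_matrix :: "real Matrix.mat \<Rightarrow> complex \<Rightarrow> complex Matrix.mat" where
  "stage_matrix A z = 1\<^sub>m (dim_row A) - z \<cdot>\<^sub>m map_mat complex_of_real A"

lemma stage_matrix_carrier [simp, intro]:
  "A \<in> carrier_mat n n \<Longrightarrow> stage_matrix A z \<in> carrier_mat n n"
  by (auto simp: stage_matrix_def)

lemma stability_function_eq:
  "stability_function (A, b) z = 1 + z * (map_vec complex_of_real b \<bullet>
     (the (mat_inverse (stage_matrix A z)) *\<^sub>v Matrix.vec (dim_row A) (\<lambda>_. 1)))"
  by (simp add: stability_function_def stage_matrix_def Let_def)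

lemma stability_function_stage_values:
  assumes A: "A \<in> carrier_mat n n"
    and det: "Determinant.det (stage_matrix A z) \<noteq> 0"
    and u: "u \<in> carrier_vec n" "stage_matrix A z *\<^sub>v u = Matrix.vec n (\<lambda>_. 1)"
  shows "stability_function (A, b) z = 1 + z * (map_vec complex_of_real b \<bullet> u)"
proof -
  have S: "stage_matrix A z \<in> carrier_mat n n"
    using A by auto
  note I = the_mat_inverse[OF S det]
  have "the (mat_inverse (stage_matrix A z)) *\<^sub>v Matrix.vec n (\<lambda>_. 1) = u"
    using assoc_mult_mat_vec[OF I(1) S u(1)] I(3) u by simp
  then show ?thesis
    using A by (simp add: stability_function_eq)
qed

lemma stage_values_exist:
  assumes A: "A \<in> carrier_mat n n"
    and det: "Determinant.det (stage_matrix A z) \<noteq> 0"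
  obtains u where "u \<in> carrier_vec n" "stage_matrix A z *\<^sub>v u = Matrix.vec n (\<lambda>_. 1)"
proof
  have S: "stage_matrix A z \<in> carrier_mat n n"
    using A by auto
  note I = the_mat_inverse[OF S det]
  show "the (mat_inverse (stage_matrix A z)) *\<^sub>v Matrix.vec n (\<lambda>_. 1) \<in> carrier_vec n"
    using I(1) by auto
  show "stage_matrix A z *\<^sub>v (the (mat_inverse (stage_matrix A z)) *\<^sub>v Matrix.vec n (\<lambda>_. 1))
      = Matrix.vec n (\<lambda>_. 1)"
    using assoc_mult_mat_vec[OF S I(1), of "Matrix.vec n (\<lambda>_. 1)"] I(2) by simp
qed

text \<open>By Cramer's rule the stability function agrees near \<open>z\<close> with a quotient whose numerator and
  denominator depend continuously on the point. The agreement holds only where the determinant does not vanish,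
  hence the restriction to a neighbourhood.\<close>
lemma isCont_stability_function:
  assumes A: "A \<in> carrier_mat n n" and b: "b \<in> carrier_vec n"
    and det: "Determinant.det (stage_matrix A z) \<noteq> 0"
  shows "isCont (stability_function (A, b)) z"
proof -
  define S where "S = stage_matrix A"
  have S: "S w \<in> carrier_mat n n" for w
    using A by (simp add: S_def)
  have entry: "isCont (\<lambda>w. S w $$ (i, j)) z" if "i < n" "j < n" for i j
  proof -
    have "S w $$ (i, j) = (if i = j then 1 else 0) - w * of_real (A $$ (i, j))" for w
      using that A by (simp add: S_def stage_matrix_def)
    then show ?thesis
      by (simp only:) (intro continuous_intros)
  qed
  have cont_det: "isCont (\<lambda>w. Determinant.det (S w)) z"
    by (rule isCont_det[OF S entry])
  have det_z: "Determinant.det (S z) \<noteq> 0"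
    using det by (simp add: S_def)
  define G where "G w = 1 + w * (\<Sum>i = 0..<n. of_real (vec_index b i)
      * (\<Sum>j = 0..<n. 1 / Determinant.det (S w) * adj_mat (S w) $$ (i, j)))" for w
  have "isCont G z"
    unfolding G_def using isCont_adj_mat[OF S entry] cont_det det_z
    by (intro continuous_intros) auto
  moreover have "eventually (\<lambda>w. Determinant.det (S w) \<noteq> 0) (nhds z)"
    using cont_det tendsto_imp_eventually_ne[OF _ det_z]
      tendsto_at_iff_tendsto_nhds[of "\<lambda>w. Determinant.det (S w)" z]
    by (auto simp: isCont_def)
  then have "eventually (\<lambda>w. stability_function (A, b) w = G w) (nhds z)"
  proof eventually_elim
    case (elim w)
    have adj: "adj_mat (S w) \<in> carrier_mat n n"
      by (rule adj_mat(1)[OF S])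
    have "stability_function (A, b) w
        = 1 + w * (map_vec complex_of_real b \<bullet>
            ((1 / Determinant.det (S w) \<cdot>\<^sub>m adj_mat (S w)) *\<^sub>v Matrix.vec n (\<lambda>_. 1)))"
      using A by (simp add: stability_function_eq flip: S_def the_mat_inverse_adj[OF S elim])
    also have "\<dots> = G w"
    proof -
      have "vec_index ((1 / Determinant.det (S w) \<cdot>\<^sub>m adj_mat (S w)) *\<^sub>v Matrix.vec n (\<lambda>_. 1)) i
          = (\<Sum>j = 0..<n. 1 / Determinant.det (S w) * adj_mat (S w) $$ (i, j))" if "i < n" for i
        using that carrier_matD[OF adj] by (simp add: scalar_prod_def)
      then show ?thesis
        unfolding G_def scalar_prod_def
        using carrier_matD[OF adj] carrier_vecD[OF b]
        by (intro arg_cong2[of _ _ _ _ "(+)"] arg_cong2[of _ _ _ _ "(*)"] sum.cong refl) auto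
    qed
    finally show ?case .
  qed
  ultimately show ?thesis
    by (simp cong: isCont_cong)
qed

definition left_half_plane_regular :: "real Matrix.mat \<Rightarrow> bool" where
  "left_half_plane_regular A \<longleftrightarrow> (\<forall>z. Re z \<le> 0 \<longrightarrow> Determinant.det (stage_matrix A z) \<noteq> 0)"

text \<open>Where the stage equations are uniquely solvable the stability function is continuous, so it
  has neither a pole nor a value to be corrected there. It remains to bound the ordinary value.\<close>
lemma A_stableI:
  assumes "A \<in> carrier_mat n n" "b \<in> carrier_vec n" "left_half_plane_regular A"
    and bound: "\<And>z. Re z \<le> 0 \<Longrightarrow> cmod (stability_function (A, b) z) \<le> 1"
  shows "A_stable (A, b)"
  unfolding A_stable_def
proof (intro allI impI)
  fix z :: complex assume z: "Re z \<le> 0"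
  then have "stability_function (A, b) \<midarrow>z\<rightarrow> stability_function (A, b) z"
    using isCont_stability_function[OF assms(1,2)] assms(3)
    by (auto simp: left_half_plane_regular_def isCont_def)
  then show "\<not> is_pole (stability_function (A, b)) z \<and>
      cmod (remove_sings (stability_function (A, b)) z) \<le> 1"
    using bound[OF z] remove_sings_eqI[of "stability_function (A, b)"]
      not_tendsto_and_filterlim_at_infinity[of "at z" "stability_function (A, b)"]
    by (auto simp: is_pole_def)
qed

lemma stage_matrix_block_diag:
  assumes "A \<in> carrier_mat m m" "B \<in> carrier_mat n n"
  shows "stage_matrix (four_block_mat A (0\<^sub>m m n) (0\<^sub>m n m) B) z
    = four_block_mat (stage_matrix A z) (0\<^sub>m m n) (0\<^sub>m n m) (stage_matrix B z)"
  using assms by (intro eq_matI) (auto simp: stage_matrix_def)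

lemma left_half_plane_regular_block_diag:
  assumes "A \<in> carrier_mat m m" "B \<in> carrier_mat n n"
    and "left_half_plane_regular A" "left_half_plane_regular B"
  shows "left_half_plane_regular (four_block_mat A (0\<^sub>m m n) (0\<^sub>m n m) B)"
proof -
  have "Determinant.det (stage_matrix (four_block_mat A (0\<^sub>m m n) (0\<^sub>m n m) B) z)
      = Determinant.det (stage_matrix A z) * Determinant.det (stage_matrix B z)" for z
    unfolding stage_matrix_block_diag[OF assms(1,2)]
    using assms(1,2) by (intro det_four_block_mat_lower_left_zero[of _ m _ n]) auto
  then show ?thesis
    using assms(3,4) by (simp add: left_half_plane_regular_def)
qed

lemma left_half_plane_regular_diag_block_mat:
  assumes "\<And>A. A \<in> set As \<Longrightarrow> square_mat A \<and> left_half_plane_regular A"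
  shows "square_mat (diag_block_mat As) \<and> left_half_plane_regular (diag_block_mat As)"
  using assms
proof (induction As)
  case Nil
  then show ?case
    by (auto simp: left_half_plane_regular_def stage_matrix_def det_def)
next
  case (Cons A As)
  define D where "D = diag_block_mat As"
  obtain m n where AD: "A \<in> carrier_mat m m" "D \<in> carrier_mat n n"
    using Cons by (auto simp: D_def)
  have reg: "left_half_plane_regular A" "left_half_plane_regular D"
    using Cons by (auto simp: D_def)
  have "diag_block_mat (A # As) = four_block_mat A (0\<^sub>m m n) (0\<^sub>m n m) D"
    using AD by (simp add: Let_def flip: D_def)
  moreover have "square_mat \<dots>"
    using AD by simp
  ultimately show ?case
    using left_half_plane_regular_block_diag[OF AD reg] by (simp only:)
qed

text \<open>The stages of a block-diagonal method decouple, and stages of weight zero do not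
  enter the update.\<close>
lemma stability_function_block_diag:
  assumes A: "A \<in> carrier_mat m m" and B: "B \<in> carrier_mat n n" and b: "b \<in> carrier_vec n"
    and reg: "left_half_plane_regular A" "left_half_plane_regular B" and z: "Re z \<le> 0"
  shows "stability_function (four_block_mat A (0\<^sub>m m n) (0\<^sub>m n m) B, 0\<^sub>v m @\<^sub>v b) z
    = stability_function (B, b) z"
proof -
  let ?C = "four_block_mat A (0\<^sub>m m n) (0\<^sub>m n m) B"
  have det: "Determinant.det (stage_matrix A z) \<noteq> 0" "Determinant.det (stage_matrix B z) \<noteq> 0"
    "Determinant.det (stage_matrix ?C z) \<noteq> 0"
    using left_half_plane_regular_block_diag[OF A B reg] reg z
    by (auto simp: left_half_plane_regular_def simp del: index_mat_four_block)
  obtain u where u: "u \<in> carrier_vec m" "stage_matrix A z *\<^sub>v u = Matrix.vec m (\<lambda>_. 1)"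
    using stage_values_exist[OF A det(1)] .
  obtain v where v: "v \<in> carrier_vec n" "stage_matrix B z *\<^sub>v v = Matrix.vec n (\<lambda>_. 1)"
    using stage_values_exist[OF B det(2)] .
  have "stage_matrix ?C z *\<^sub>v (u @\<^sub>v v) = Matrix.vec m (\<lambda>_. 1) @\<^sub>v Matrix.vec n (\<lambda>_. 1)"
    unfolding stage_matrix_block_diag[OF A B] u(2)[symmetric] v(2)[symmetric]
    using A B u(1) v(1) by (intro mult_mat_vec_split) auto
  also have "\<dots> = Matrix.vec (m + n) (\<lambda>_. 1)"
    by (intro eq_vecI) auto
  finally have sol: "stage_matrix ?C z *\<^sub>v (u @\<^sub>v v) = Matrix.vec (m + n) (\<lambda>_. 1)" .
  have "stability_function (?C, 0\<^sub>v m @\<^sub>v b) z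
      = 1 + z * (map_vec complex_of_real (0\<^sub>v m @\<^sub>v b) \<bullet> (u @\<^sub>v v))"
    using A B det(3) sol u(1) v(1) by (intro stability_function_stage_values[of _ "m + n"]) auto
  also have "map_vec complex_of_real (0\<^sub>v m @\<^sub>v b) = 0\<^sub>v m @\<^sub>v map_vec complex_of_real b"
    using b by (intro eq_vecI) auto
  also have "(0\<^sub>v m @\<^sub>v map_vec complex_of_real b) \<bullet> (u @\<^sub>v v)
      = 0\<^sub>v m \<bullet> u + map_vec complex_of_real b \<bullet> v"
    using b u(1) v(1) by (intro scalar_prod_append[of _ m _ n]) auto
  also have "0\<^sub>v m \<bullet> u = 0"
    using u(1) by simp
  finally show ?thesis
    using stability_function_stage_values[OF B det(2) v] by simp
qed

text \<open>The last copy of \<open>Q\<close> alone carries weights, so the method has the stability function of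
  \<open>(Q, b)\<close>; the other blocks only have to be solvable.\<close>
lemma A_stable_repeated_stages:
  assumes Q: "Q \<in> carrier_mat n n" and b: "b \<in> carrier_vec n" and reg: "left_half_plane_regular Q"
    and bound: "\<And>z. Re z \<le> 0 \<Longrightarrow> cmod (stability_function (Q, b) z) \<le> 1" and "K \<ge> 1"
  shows "A_stable (diag_block_mat (0\<^sub>m 1 1 # replicate K Q), 0\<^sub>v (1 + (K - 1) * n) @\<^sub>v b)"
proof -
  let ?As = "0\<^sub>m 1 1 # replicate (K - 1) Q"
  define D where "D = diag_block_mat ?As"
  let ?m = "1 + (K - 1) * n"
  have "left_half_plane_regular (0\<^sub>m 1 1)"
    by (simp add: left_half_plane_regular_def stage_matrix_def det_def)
  then have D_reg: "square_mat D \<and> left_half_plane_regular D"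
    unfolding D_def using Q reg by (intro left_half_plane_regular_diag_block_mat) auto
  moreover have "dim_row D = ?m"
    using Q by (simp add: D_def dim_diag_block_mat sum_list_replicate)
  ultimately have D: "D \<in> carrier_mat ?m ?m"
    by auto
  have "replicate K Q = replicate (K - 1) Q @ [Q]"
    using \<open>K \<ge> 1\<close> by (cases K) (simp_all add: replicate_append_same)
  then have "diag_block_mat (0\<^sub>m 1 1 # replicate K Q) = diag_block_mat (?As @ [Q])"
    by (simp only: append_Cons)
  also have "\<dots> = four_block_mat D (0\<^sub>m (dim_row D) (dim_col Q)) (0\<^sub>m (dim_row Q) (dim_col D)) Q"
    by (simp only: diag_block_mat_append diag_block_mat_singleton Let_def D_def)
  finally have block: "diag_block_mat (0\<^sub>m 1 1 # replicate K Q)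
      = four_block_mat D (0\<^sub>m ?m n) (0\<^sub>m n ?m) Q"
    by (simp only: carrier_matD[OF D] carrier_matD[OF Q])
  show ?thesis
    unfolding block
  proof (rule A_stableI)
    show "four_block_mat D (0\<^sub>m ?m n) (0\<^sub>m n ?m) Q \<in> carrier_mat (?m + n) (?m + n)"
      using D Q by (rule four_block_carrier_mat)
    show "0\<^sub>v ?m @\<^sub>v b \<in> carrier_vec (?m + n)"
      using b by (intro append_carrier_vec) auto
    show "left_half_plane_regular (four_block_mat D (0\<^sub>m ?m n) (0\<^sub>m n ?m) Q)"
      using D_reg by (intro left_half_plane_regular_block_diag D Q reg) auto
    show "cmod (stability_function (four_block_mat D (0\<^sub>m ?m n) (0\<^sub>m n ?m) Q, 0\<^sub>v ?m @\<^sub>v b) z) \<le> 1"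
      if "Re z \<le> 0" for z
      using stability_function_block_diag[OF D Q b _ reg that] D_reg bound[OF that] by simp
  qed
qed

section \<open>The ADER matrices\<close>

text \<open>Multiplying \<open>Id - z Q\<close> from the left by \<^const>\<open>ader_M\<close> gives this matrix, the matrix of the
  Galerkin equation in the Lagrange basis; no inverse occurs in it.\<close>
definition ader_pencil :: "nat \<Rightarrow> complex \<Rightarrow> complex Matrix.mat" where
  "ader_pencil M z = map_mat complex_of_real (ader_M M) - z \<cdot>\<^sub>m map_mat complex_of_real (ader_R M)"

lemma ader_M_carrier [simp]: "ader_M M \<in> carrier_mat (M + 1) (M + 1)"
  by (simp add: ader_M_def)

lemma ader_R_carrier [simp]: "ader_R M \<in> carrier_mat (M + 1) (M + 1)"
  by (simp add: ader_R_def)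

lemma ader_b_carrier [simp]: "ader_b M \<in> carrier_vec (M + 1)"
  by (simp add: ader_b_def)

lemma ader_pencil_carrier [simp]: "ader_pencil M z \<in> carrier_mat (M + 1) (M + 1)"
  unfolding ader_pencil_def
  by (intro minus_carrier_mat smult_carrier_mat map_carrier_mat[THEN iffD2] ader_R_carrier)

lemma index_ader_M:
  "i \<le> M \<Longrightarrow> j \<le> M \<Longrightarrow> ader_M M $$ (i, j) = ader_form (lagrange_basis M i) (lagrange_basis M j)"
  by (simp add: ader_M_def ader_form_def unit_integral_def poly_mult[abs_def])

lemma index_ader_R:
  "i \<le> M \<Longrightarrow> j \<le> M \<Longrightarrow> ader_R M $$ (i, j) = unit_integral (lagrange_basis M i * lagrange_basis M j)"
  by (simp add: ader_R_def unit_integral_def poly_mult[abs_def])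

lemma index_ader_b: "i \<le> M \<Longrightarrow> vec_index (ader_b M) i = unit_integral (lagrange_basis M i)"
  by (simp add: ader_b_def unit_integral_def)

lemma index_ader_pencil_mult_vec:
  assumes "v \<in> carrier_vec (M + 1)" "i \<le> M"
  shows "vec_index (ader_pencil M z *\<^sub>v v) i
    = (\<Sum>j\<le>M. (of_real (ader_form (lagrange_basis M i) (lagrange_basis M j))
         - z * of_real (unit_integral (lagrange_basis M i * lagrange_basis M j))) * vec_index v j)"
proof -
  have "ader_pencil M z $$ (i, j)
      = of_real (ader_form (lagrange_basis M i) (lagrange_basis M j))
         - z * of_real (unit_integral (lagrange_basis M i * lagrange_basis M j))" if "j \<le> M" for j
    using that assms(2) carrier_matD[OF ader_M_carrier] carrier_matD[OF ader_R_carrier]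
    by (simp add: ader_pencil_def index_ader_M index_ader_R)
  moreover have "{0..<M + 1} = {..M}"
    by auto
  ultimately show ?thesis
    using assms carrier_matD[OF ader_pencil_carrier] by (simp add: scalar_prod_def)
qed

lemma galerkin_solution_of_vec:
  assumes "v \<in> carrier_vec (M + 1)"
    and "ader_pencil M z *\<^sub>v v = Matrix.vec (M + 1) (\<lambda>i. of_real (c * poly (lagrange_basis M i) 0))"
  shows "galerkin_solution M z c
    (nodal_poly M (\<lambda>j. Re (vec_index v j))) (nodal_poly M (\<lambda>j. Im (vec_index v j)))"
proof (rule galerkin_solution_nodal)
  fix i assume i: "i \<le> M"
  show "(\<Sum>j\<le>M. (of_real (ader_form (lagrange_basis M i) (lagrange_basis M j))
         - z * of_real (unit_integral (lagrange_basis M i * lagrange_basis M j))) * vec_index v j)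
      = of_real (c * poly (lagrange_basis M i) 0)"
    unfolding index_ader_pencil_mult_vec[OF assms(1) i, symmetric] assms(2) using i by simp
qed

text \<open>A kernel vector consists of the nodal values of a solution of the homogeneous Galerkin
  equation.\<close>
lemma det_ader_pencil:
  assumes z: "Re z \<le> 0"
  shows "Determinant.det (ader_pencil M z) \<noteq> 0"
proof
  assume "Determinant.det (ader_pencil M z) = 0"
  then obtain v where v: "v \<in> carrier_vec (M + 1)" "v \<noteq> 0\<^sub>v (M + 1)"
      "ader_pencil M z *\<^sub>v v = 0\<^sub>v (M + 1)"
    unfolding det_0_iff_vec_prod_zero_field[OF ader_pencil_carrier] by blast
  have "galerkin_solution M z 0
      (nodal_poly M (\<lambda>j. Re (vec_index v j))) (nodal_poly M (\<lambda>j. Im (vec_index v j)))"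
    using v(1,3) by (intro galerkin_solution_of_vec) auto
  then have zero: "nodal_poly M (\<lambda>j. Re (vec_index v j)) = 0" "nodal_poly M (\<lambda>j. Im (vec_index v j)) = 0"
    using galerkin_homogeneous_trivial[OF _ degree_nodal_poly degree_nodal_poly z] by blast+
  have "vec_index v j = 0" if "j \<le> M" for j
    using poly_nodal_poly_node[OF that, of "\<lambda>j. Re (vec_index v j)"]
      poly_nodal_poly_node[OF that, of "\<lambda>j. Im (vec_index v j)"]
    by (simp add: zero complex_eq_iff)
  then have "v = 0\<^sub>v (M + 1)"
    using v(1) by (intro eq_vecI) auto
  with v(2) show False ..
qed

text \<open>The matrix is the pencil at \<open>z = 0\<close>, a point of the closed left half-plane.\<close>
lemma det_ader_M: "Determinant.det (ader_M M) \<noteq> 0"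
proof -
  have "ader_pencil M 0 = map_mat complex_of_real (ader_M M)"
    using carrier_matD[OF ader_M_carrier] carrier_matD[OF ader_R_carrier]
    by (intro eq_matI) (simp_all add: ader_pencil_def)
  then show ?thesis
    using det_ader_pencil[of 0 M] by (simp add: of_real_hom.hom_det)
qed

lemma ader_Q_carrier [simp]: "ader_Q M \<in> carrier_mat (M + 1) (M + 1)"
  unfolding ader_Q_def
  by (rule mult_carrier_mat[OF the_mat_inverse(1)[OF ader_M_carrier det_ader_M] ader_R_carrier])

lemma ader_M_mult_Q: "ader_M M * ader_Q M = ader_R M"
proof -
  note I = the_mat_inverse[OF ader_M_carrier det_ader_M]
  have "ader_M M * ader_Q M = (ader_M M * the (mat_inverse (ader_M M))) * ader_R M"
    unfolding ader_Q_def by (rule assoc_mult_mat[OF ader_M_carrier I(1) ader_R_carrier, symmetric])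
  then show ?thesis
    by (simp only: I(2) left_mult_one_mat[OF ader_R_carrier])
qed

lemma ader_M_mult_stage_matrix:
  "map_mat complex_of_real (ader_M M) * stage_matrix (ader_Q M) z = ader_pencil M z"
proof -
  let ?M = "map_mat complex_of_real (ader_M M)" and ?Q = "map_mat complex_of_real (ader_Q M)"
  have c: "?M \<in> carrier_mat (M + 1) (M + 1)" "?Q \<in> carrier_mat (M + 1) (M + 1)"
    by (simp_all only: map_carrier_mat ader_M_carrier ader_Q_carrier)
  have "stage_matrix (ader_Q M) z = 1\<^sub>m (M + 1) - z \<cdot>\<^sub>m ?Q"
    using carrier_matD[OF ader_Q_carrier] by (simp add: stage_matrix_def)
  also have "?M * \<dots> = ?M * 1\<^sub>m (M + 1) - ?M * (z \<cdot>\<^sub>m ?Q)"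
    using c by (intro mult_minus_distrib_mat) auto
  also have "?M * 1\<^sub>m (M + 1) = ?M"
    by (rule right_mult_one_mat[OF c(1)])
  also have "?M * (z \<cdot>\<^sub>m ?Q) = z \<cdot>\<^sub>m (?M * ?Q)"
    by (rule mult_smult_distrib[OF c])
  also have "?M * ?Q = map_mat complex_of_real (ader_R M)"
    by (simp only: of_real_hom.mat_hom_mult[OF ader_M_carrier ader_Q_carrier, symmetric] ader_M_mult_Q)
  finally show ?thesis
    by (simp add: ader_pencil_def)
qed

lemma left_half_plane_regular_ader_Q: "left_half_plane_regular (ader_Q M)"
  unfolding left_half_plane_regular_def
proof (intro allI impI)
  fix z :: complex assume "Re z \<le> 0"
  then have "Determinant.det (map_mat complex_of_real (ader_M M) * stage_matrix (ader_Q M) z) \<noteq> 0"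
    by (simp add: ader_M_mult_stage_matrix det_ader_pencil)
  then show "Determinant.det (stage_matrix (ader_Q M) z) \<noteq> 0"
    using det_mult[OF map_carrier_mat[THEN iffD2, OF ader_M_carrier] stage_matrix_carrier[OF ader_Q_carrier]]
    by auto
qed

text \<open>The Lagrange polynomials sum to \<open>1\<close>, and \<open>a(v, 1) = v(0)\<close>. This translates the
  right-hand side of the stage equations into the initial value \<open>1\<close> of the Galerkin equation.\<close>
lemma ader_M_mult_ones:
  "map_mat complex_of_real (ader_M M) *\<^sub>v Matrix.vec (M + 1) (\<lambda>_. 1)
    = Matrix.vec (M + 1) (\<lambda>i. of_real (poly (lagrange_basis M i) 0))"
proof -
  have ones: "(\<Sum>j\<le>M. Polynomial.smult 1 (lagrange_basis M j)) = 1"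
    using nodal_poly_interpolates[of 1 M] by (simp add: nodal_poly_def)
  have "(\<Sum>j\<le>M. ader_M M $$ (i, j)) = poly (lagrange_basis M i) 0" if "i \<le> M" for i
    using ader_form_sum_right[of "lagrange_basis M i" "\<lambda>_. 1" "lagrange_basis M" "{..M}"] that
    unfolding ones by (simp add: index_ader_M ader_form_by_parts)
  moreover have "{0..<M + 1} = {..M}"
    by auto
  ultimately show ?thesis
    using carrier_matD[OF ader_M_carrier]
    by (intro eq_vecI) (simp_all add: scalar_prod_def flip: of_real_sum)
qed

text \<open>The polynomial with the stage values as nodal values solves the Galerkin equation, and its end
  value is the value of the stability function at \<open>z\<close>.\<close>
lemma stability_function_ader_le_1:
  assumes z: "Re z \<le> 0"
  shows "cmod (stability_function (ader_Q M, ader_b M) z) \<le> 1"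
proof -
  let ?M = "map_mat complex_of_real (ader_M M)"
  have det: "Determinant.det (stage_matrix (ader_Q M) z) \<noteq> 0"
    using left_half_plane_regular_ader_Q z by (simp add: left_half_plane_regular_def)
  obtain u where u: "u \<in> carrier_vec (M + 1)"
      "stage_matrix (ader_Q M) z *\<^sub>v u = Matrix.vec (M + 1) (\<lambda>_. 1)"
    using stage_values_exist[OF ader_Q_carrier det] .
  define p q where "p = nodal_poly M (\<lambda>j. Re (vec_index u j))"
    and "q = nodal_poly M (\<lambda>j. Im (vec_index u j))"
  have "ader_pencil M z *\<^sub>v u = ?M *\<^sub>v Matrix.vec (M + 1) (\<lambda>_. 1)"
    unfolding u(2)[symmetric] ader_M_mult_stage_matrix[symmetric]
    by (rule assoc_mult_mat_vec[OF map_carrier_mat[THEN iffD2, OF ader_M_carrier]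
          stage_matrix_carrier[OF ader_Q_carrier] u(1)])
  then have sol: "galerkin_solution M z 1 p q"
    unfolding p_def q_def using u(1) by (intro galerkin_solution_of_vec) (simp_all add: ader_M_mult_ones[simplified])
  have "unit_integral p = (\<Sum>j\<le>M. Re (vec_index u j) * vec_index (ader_b M) j)"
    "unit_integral q = (\<Sum>j\<le>M. Im (vec_index u j) * vec_index (ader_b M) j)"
    by (simp_all add: p_def q_def nodal_poly_def unit_integral_sum unit_integral_smult index_ader_b)
  moreover have "{0..<M + 1} = {..M}"
    by auto
  ultimately have "map_vec complex_of_real (ader_b M) \<bullet> u = Complex (unit_integral p) (unit_integral q)"
    using u(1) carrier_vecD[OF ader_b_carrier]
    by (simp add: scalar_prod_def complex_eq_iff mult.commute)
  then have "stability_function (ader_Q M, ader_b M) z = Complex (poly p 1) (poly q 1)"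
    using stability_function_stage_values[OF ader_Q_carrier det u] galerkin_end_value[OF sol] by simp
  then show ?thesis
    using galerkin_end_value_le_1[OF sol _ _ z] degree_nodal_poly by (simp add: p_def q_def)
qed

theorem corollary3p7:
  shows "(\<forall>M::nat. A_stable (ader_iwf_rk M)) \<and>
         (\<forall>(M::nat) (K::nat). K \<ge> 1 \<longrightarrow> A_stable (im_ader M K))"
proof (intro conjI allI impI)
  show "A_stable (ader_iwf_rk M)" for M
    unfolding ader_iwf_rk_def
    by (rule A_stableI[OF ader_Q_carrier ader_b_carrier left_half_plane_regular_ader_Q])
      (rule stability_function_ader_le_1)
  show "A_stable (im_ader M K)" if "K \<ge> 1" for M K :: nat
    unfolding im_ader_def
    by (rule A_stable_repeated_stages[OF ader_Q_carrier ader_b_carrier left_half_plane_regular_ader_Q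
          stability_function_ader_le_1 that])
qed

end
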